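(* Let $p$ be a prime, let $k\ge1$ be an integer, and let $g(x)\in\mathbb{Z}[x]$ be a polynomial. Then the number of tuples $(x_1,\dots,x_k)$ of integers with $1\le x_i\le p(p-1)$ and $p\nmid x_i$ for all $i=1,\dots,k$ satisfying the congruences $$x_1^{g(x_1)}\equiv x_2\pmod p,\quad x_2^{g(x_2)}\equiv x_3\pmod p,\quad\ldots,\quad x_k^{g(x_k)}\equiv x_1\pmod p$$ is $$\sum_{x_{01}=1}^{p-1}\cdots\sum_{x_{0k}=1}^{p-1}\gcd\bigl(p-1,\;g(x_{01})\cdots g(x_{0k})-1\bigr)=\sum_{d\mid p-1}\phi(d)\left(\frac{p-1}{d}\right)^k N_{G-1}(d).$$
   Context: $\phi$ is the Euler phi function. For a positive integer $d$, $N_{G-1}(d)$ is the number of tuples $(z_1,\dots,z_k)\in(\mathbb{Z}/d\mathbb{Z})^k$ with $g(z_1)\cdots g(z_k)-1\equiv 0\pmod d$. If an exponent $g(x_i)$ is negative, $x_i^{g(x_i)}$ modulo $p$ is computed using the inverse of $x_i$ modulo $p$. Convention: $\gcd(m,0)=m$. *)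

theory Defs
  imports "HOL-Number_Theory.Number_Theory" "HOL-Computational_Algebra.Polynomial"
begin

text \<open>
  A representative of the residue class of \<open>x\<close> to the power \<open>e\<close> modulo \<open>m\<close>, where \<open>e\<close> may be
  negative. It is only meaningful for \<open>e < 0\<close> if \<open>x\<close> is coprime to \<open>m\<close>, since
  \<open>modular_inverse m x = 0\<close> otherwise.
\<close>
definition mod_power_int :: "int \<Rightarrow> int \<Rightarrow> int \<Rightarrow> int" where
  "mod_power_int m x e =
     (if e \<ge> 0 then x ^ nat e else modular_inverse m x ^ nat (- e))"

text \<open>
  The ring of integers modulo \<open>d\<close> is represented by the residues \<open>0, \<dots>, d - 1\<close>;
  the condition does not depend on the choice of representatives because \<open>g\<close> has integer
  coefficients. A \<open>k\<close>-tuple is an extensional function on \<open>{1..k}\<close>.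
\<close>
definition N_G_minus_1 :: "int poly \<Rightarrow> nat \<Rightarrow> nat \<Rightarrow> nat" where
  "N_G_minus_1 g k d =
     card {z \<in> {1..k} \<rightarrow>\<^sub>E {0..<int d}. [(\<Prod>i=1..k. poly g (z i)) - 1 = 0] (mod int d)}"

end

theory Submission
  imports Defs
begin

text \<open>
  Put \<open>n = p - 1\<close>. Since \<open>p\<close> and \<open>n\<close> are coprime, an integer \<open>x\<close> between \<open>1\<close> and \<open>p * n\<close>
  that is prime to \<open>p\<close> amounts to two independent pieces of data: a residue \<open>y\<close> of \<open>x\<close> modulo \<open>n\<close>
  and a nonzero residue of \<open>x\<close> modulo \<open>p\<close>, the latter being determined by its discrete
  logarithm \<open>t\<close>, a residue modulo \<open>n\<close> again (\<open>bij_betw_log_fibre\<close>). The exponent \<open>g(x)\<close> matters only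
  modulo \<open>n\<close> and so depends on \<open>y\<close> alone. Hence, once the residues \<open>y\<^sub>1, \<dots>, y\<^sub>k\<close> are fixed,
  taking logarithms turns the congruences into the linear cycle
  \<open>g(y\<^sub>i) t\<^sub>i \<equiv> t\<^sub>i\<^sub>+\<^sub>1\<close>, \<open>g(y\<^sub>k) t\<^sub>k \<equiv> t\<^sub>1\<close> modulo \<open>n\<close>. Everything is determined by \<open>t\<^sub>1\<close>, whose only
  constraint is \<open>(g(y\<^sub>1) \<cdots> g(y\<^sub>k) - 1) t\<^sub>1 \<equiv> 0\<close>, so there are
  \<open>gcd (n, g(y\<^sub>1) \<cdots> g(y\<^sub>k) - 1)\<close> solutions (\<open>card_linear_cycle\<close>). Summing over all \<open>y\<close> gives the
  first formula.

  For the second one, a gcd is expanded by Gauss' identity as the sum of \<open>\<phi>(d)\<close> over its divisors \<open>d\<close>,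
  and the two summations are exchanged. What remains for each \<open>d\<close> dividing \<open>n\<close> is the number of
  tuples modulo \<open>n\<close> with \<open>g(y\<^sub>1) \<cdots> g(y\<^sub>k) \<equiv> 1\<close> modulo \<open>d\<close>; this condition only sees the tuple
  modulo \<open>d\<close>, and every tuple modulo \<open>d\<close> has \<open>(n / d)\<^sup>k\<close> lifts (\<open>card_tuples_product_cong_1\<close>).
\<close>

section \<open>Counting along bijections and fibres\<close>

lemma card_Collect_bij_betw:
  assumes "bij_betw f A B" and "\<And>x. x \<in> A \<Longrightarrow> P x \<longleftrightarrow> Q (f x)"
  shows "card {x \<in> A. P x} = card {y \<in> B. Q y}"
proof (rule bij_betw_same_card)
  show "bij_betw f {x \<in> A. P x} {y \<in> B. Q y}"
    using assms unfolding bij_betw_def inj_on_def by auto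
qed

lemma bij_betw_PiE_componentwise:
  assumes "\<And>i. i \<in> I \<Longrightarrow> bij_betw (f i) (A i) (B i)"
  shows "bij_betw (\<lambda>x. \<lambda>i\<in>I. f i (x i)) (\<Pi>\<^sub>E i\<in>I. A i) (\<Pi>\<^sub>E i\<in>I. B i)"
proof (rule bij_betwI[where g = "\<lambda>y. \<lambda>i\<in>I. inv_into (A i) (f i) (y i)"])
  show "(\<lambda>x. \<lambda>i\<in>I. f i (x i)) \<in> (\<Pi>\<^sub>E i\<in>I. A i) \<rightarrow> (\<Pi>\<^sub>E i\<in>I. B i)"
    using assms by (fastforce dest: bij_betwE)
  show "(\<lambda>y. \<lambda>i\<in>I. inv_into (A i) (f i) (y i)) \<in> (\<Pi>\<^sub>E i\<in>I. B i) \<rightarrow> (\<Pi>\<^sub>E i\<in>I. A i)"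
    using assms by (auto simp: bij_betw_def PiE_iff intro!: inv_into_into)
next
  fix x assume "x \<in> (\<Pi>\<^sub>E i\<in>I. A i)"
  then show "(\<lambda>i\<in>I. inv_into (A i) (f i) ((\<lambda>i\<in>I. f i (x i)) i)) = x"
    using assms
    by (intro ext) (auto simp: bij_betw_def PiE_iff extensional_def restrict_def)
next
  fix y assume "y \<in> (\<Pi>\<^sub>E i\<in>I. B i)"
  then show "(\<lambda>i\<in>I. f i ((\<lambda>i\<in>I. inv_into (A i) (f i) (y i)) i)) = y"
    using assms
    by (intro ext) (auto simp: bij_betw_def PiE_iff extensional_def restrict_def f_inv_into_f)
qed

lemma card_eq_sum_card_fibres:
  assumes "finite S" "finite T" "f ` S \<subseteq> T"
  shows "card S = (\<Sum>y\<in>T. card {x \<in> S. f x = y})"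
  using sum.group[OF assms, of "\<lambda>_. 1::nat"] by simp

section \<open>Cycles of linear congruences\<close>

lemma dvd_mult_iff_dvd_div_gcd:
  fixes n a t :: int
  assumes "n > 0"
  shows "n dvd a * t \<longleftrightarrow> n div gcd n a dvd t"
proof -
  define d where "d = gcd n a"
  have d: "d > 0" using assms by (simp add: d_def)
  obtain m where m: "n = d * m" using d_def by (metis dvdE gcd_dvd1)
  obtain b where b: "a = d * b" using d_def by (metis dvdE gcd_dvd2)
  have "d = d * gcd m b"
    using d by (metis d_def m b gcd_mult_distrib_int abs_of_pos)
  then have "coprime m b" using d by (simp add: coprime_iff_gcd_eq_1)
  moreover have "n dvd a * t \<longleftrightarrow> m dvd b * t"
    using d by (simp add: m b mult.assoc)
  moreover have "n div d = m" using d m by simp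
  ultimately show ?thesis by (simp add: d_def[symmetric] coprime_dvd_mult_right_iff)
qed

text \<open>
  The solutions are the multiples of \<open>n / gcd (n, a)\<close>, of which \<open>gcd (n, a)\<close> lie in a full period.
\<close>
lemma card_linear_congruence:
  fixes n a :: int
  assumes "n > 0"
  shows "int (card {t \<in> {0..<n}. [a * t = 0] (mod n)}) = gcd n a"
proof -
  define d m where "d = gcd n a" and "m = n div gcd n a"
  have d: "d > 0" using assms by (simp add: d_def)
  have n: "n = d * m" by (simp add: d_def m_def)
  have m: "m > 0" using assms d n by (simp add: zero_less_mult_iff)
  have sol: "[a * t = 0] (mod n) \<longleftrightarrow> m dvd t" for t
    by (simp add: cong_0_iff dvd_mult_iff_dvd_div_gcd[OF assms] m_def)
  have "bij_betw (\<lambda>j. m * j) {0..<d} {t \<in> {0..<n}. [a * t = 0] (mod n)}"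
  proof (rule bij_betwI[where g = "\<lambda>t. t div m"])
    show "(\<lambda>j. m * j) \<in> {0..<d} \<rightarrow> {t \<in> {0..<n}. [a * t = 0] (mod n)}"
      using m by (auto simp: sol) (simp add: n mult.commute)
    show "(\<lambda>t. t div m) \<in> {t \<in> {0..<n}. [a * t = 0] (mod n)} \<rightarrow> {0..<d}"
      unfolding sol using m by (auto simp: n zero_le_mult_iff elim!: dvdE)
  qed (use m in \<open>auto simp: sol\<close>)
  then have "card {0..<d} = card {t \<in> {0..<n}. [a * t = 0] (mod n)}"
    by (rule bij_betw_same_card)
  moreover have "int (card {0..<d}) = d" using d by simp
  ultimately show ?thesis by (simp only: d_def)
qed

lemma cong_along_chain:
  fixes e t :: "nat \<Rightarrow> int"
  assumes "\<forall>i\<in>{1..<k}. [e i * t i = t (i + 1)] (mod n)" and "1 \<le> i" and "i \<le> k"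
  shows "[t i = (\<Prod>j=1..<i. e j) * t 1] (mod n)"
  using assms(2,3)
proof (induction i rule: dec_induct)
  case base
  show ?case by simp
next
  case (step i)
  have "[t (i + 1) = e i * t i] (mod n)"
    using assms(1) step by (simp add: cong_sym)
  also have "[e i * t i = e i * ((\<Prod>j=1..<i. e j) * t 1)] (mod n)"
    using step by (intro cong_scalar_left) simp
  finally show ?case using step by (simp add: mult_ac)
qed

text \<open>
  Following the chain from \<open>t 1\<close> determines every other \<open>t i\<close>; closing the cycle leaves a single linear
  congruence for \<open>t 1\<close>.
\<close>
lemma card_linear_cycle:
  fixes e :: "nat \<Rightarrow> int" and n :: int
  assumes "n > 0" and "k \<ge> 1"
  shows "int (card {t \<in> {1..k} \<rightarrow>\<^sub>E {0..<n}. (\<forall>i\<in>{1..<k}. [e i * t i = t (i + 1)] (mod n)) \<and>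
             [e k * t k = t 1] (mod n)}) = gcd n ((\<Prod>i=1..k. e i) - 1)"
proof -
  (* E i is the factor by which the first i - 1 congruences multiply the starting value t 1. *)
  define E where "E = (\<lambda>i::nat. \<Prod>j=1..<i. e j)"
  have E_Suc: "E (Suc i) = e i * E i" if "1 \<le> i" for i
    using that by (simp add: E_def mult.commute)
  have E_total: "(\<Prod>i=1..k. e i) = e k * E k"
    using E_Suc[OF assms(2)] by (simp add: E_def atLeastLessThanSuc_atLeastAtMost)
  let ?T = "{t \<in> {1..k} \<rightarrow>\<^sub>E {0..<n}. (\<forall>i\<in>{1..<k}. [e i * t i = t (i + 1)] (mod n)) \<and>
             [e k * t k = t 1] (mod n)}"
  let ?S = "{s \<in> {0..<n}. [((\<Prod>i=1..k. e i) - 1) * s = 0] (mod n)}"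
  have S_iff: "s \<in> ?S \<longleftrightarrow> s \<in> {0..<n} \<and> [e k * (E k * s) = s] (mod n)" for s
    unfolding E_total by (simp add: cong_iff_dvd_diff algebra_simps)
  have chain: "[t i = E i * t 1] (mod n)" if "t \<in> ?T" "i \<in> {1..k}" for t i
    using that cong_along_chain[of k e t n i] by (simp add: E_def)
  have "bij_betw (\<lambda>t. t 1) ?T ?S"
  proof (rule bij_betwI[where g = "\<lambda>s. \<lambda>i\<in>{1..k}. (E i * s) mod n"])
    show "(\<lambda>t. t 1) \<in> ?T \<rightarrow> ?S"
    proof
      fix t assume t: "t \<in> ?T"
      have "[e k * (E k * t 1) = e k * t k] (mod n)"
        using chain[OF t, of k] assms by (intro cong_scalar_left) (simp add: cong_sym)
      also have "[e k * t k = t 1] (mod n)" using t by simp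
      finally show "t 1 \<in> ?S" unfolding S_iff using t assms by auto
    qed
    show "(\<lambda>s. \<lambda>i\<in>{1..k}. (E i * s) mod n) \<in> ?S \<rightarrow> ?T"
    proof
      fix s assume "s \<in> ?S"
      then have s: "s \<in> {0..<n}" "[e k * (E k * s) = s] (mod n)" by (simp_all only: S_iff)
      have "[e i * (E i * s mod n) = E (i + 1) * s mod n] (mod n)" if "1 \<le> i" for i
        using E_Suc[OF that] by (simp add: cong_def mod_mult_right_eq mult.assoc)
      moreover have "[e k * (E k * s mod n) = E 1 * s mod n] (mod n)"
        using s by (simp add: E_def cong_def mod_mult_right_eq)
      ultimately show "(\<lambda>i\<in>{1..k}. (E i * s) mod n) \<in> ?T"
        using assms by auto
    qed
  next
    fix t assume t: "t \<in> ?T"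
    show "(\<lambda>i\<in>{1..k}. (E i * t 1) mod n) = t"
    proof
      fix i
      show "(\<lambda>i\<in>{1..k}. (E i * t 1) mod n) i = t i"
      proof (cases "i \<in> {1..k}")
        case True
        then have "t i \<in> {0..<n}" using t by (auto simp: PiE_iff)
        then show ?thesis using chain[OF t True] True by (simp add: cong_def)
      next
        case False
        then show ?thesis using t by (auto simp: PiE_iff extensional_def)
      qed
    qed
  next
    fix s assume "s \<in> ?S"
    then show "(\<lambda>i\<in>{1..k}. (E i * s) mod n) 1 = s"
      using assms by (simp add: E_def)
  qed
  then have "card ?T = card ?S" by (rule bij_betw_same_card)
  then show ?thesis using card_linear_congruence[OF assms(1)] by simp
qed

section \<open>Discrete logarithms modulo a prime\<close>

text \<open>
  The isomorphism between the unit group modulo \<open>p\<close> and the additive group modulo \<open>p - 1\<close> given by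
  a primitive root. It is stated by congruences between integers, so that no representatives have to be
  chosen when exponents are multiplied; the three properties are well-definedness together with
  injectivity, surjectivity, and the homomorphism law.
\<close>
lemma obtain_discrete_log:
  assumes "prime p"
  obtains L :: "int \<Rightarrow> int" where
    "\<And>a b. \<lbrakk>\<not> int p dvd a; \<not> int p dvd b\<rbrakk> \<Longrightarrow> [a = b] (mod int p) \<longleftrightarrow> [L a = L b] (mod int (p - 1))"
    "\<And>t. \<exists>a. \<not> int p dvd a \<and> [L a = t] (mod int (p - 1))"
    "\<And>a b. \<lbrakk>\<not> int p dvd a; \<not> int p dvd b\<rbrakk> \<Longrightarrow> [L (a * b) = L a + L b] (mod int (p - 1))"
proof -
  have p: "p > 1" using assms prime_gt_1_nat by blast
  obtain r where r: "residue_primroot p r"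
    using prime_primitive_root_exists[OF p assms] by blast
  then have cop: "coprime p r" and ord: "ord p r = p - 1"
    using assms by (auto simp: residue_primroot_def totient_prime)
  have pow: "[int r ^ s = int r ^ t] (mod int p) \<longleftrightarrow> [int s = int t] (mod int (p - 1))" for s t
    using order_divides_expdiff[OF cop, of s t] by (simp add: ord flip: cong_int_iff)
  have unit: "\<not> int p dvd int r ^ t" for t
    using cop p assms
    by (metis coprime_absorb_left coprime_power_right_iff int_dvd_int_iff of_nat_power nat_dvd_1_iff_1 less_irrefl)
  have ex: "\<exists>t. [int r ^ t = a] (mod int p)" if a: "\<not> int p dvd a" for a
  proof -
    define u where "u = nat (a mod int p)"
    have u: "int u = a mod int p" using p by (simp add: u_def)
    have "a mod int p \<noteq> 0" using a by (simp add: dvd_eq_mod_eq_0)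
    moreover have "a mod int p < int p" using p by simp
    ultimately have "u \<in> totatives p"
      using u unfolding totatives_prime[OF assms] by simp
    then have "u \<in> (\<lambda>i. r ^ i mod p) ` {..<totient p}"
      using residue_primroot_is_generator[OF p r] by (simp only: bij_betw_def)
    then obtain t where "r ^ t mod p = u" by blast
    then have "int (r ^ t mod p) = a mod int p" using u by (simp only:)
    then have "int r ^ t mod int p = a mod int p" by (simp only: of_nat_mod of_nat_power)
    then show ?thesis by (auto simp: cong_def)
  qed
  define L where "L a = int (SOME t. [int r ^ t = a] (mod int p))" for a
  have L: "[int r ^ nat (L a) = a] (mod int p)" "int (nat (L a)) = L a" if "\<not> int p dvd a" for a
    using someI_ex[OF ex[OF that]] by (simp_all add: L_def)
  have L_eqI: "[L a = int t] (mod int (p - 1))" if "\<not> int p dvd a" "[int r ^ t = a] (mod int p)" for a t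
    using L[OF that(1)] that(2) pow[of "nat (L a)" t] by (metis cong_sym cong_trans)
  show thesis
  proof
    fix a b assume ab: "\<not> int p dvd a" "\<not> int p dvd b"
    show "[a = b] (mod int p) \<longleftrightarrow> [L a = L b] (mod int (p - 1))"
      using L[OF ab(1)] L[OF ab(2)] pow[of "nat (L a)" "nat (L b)"] by (metis cong_sym cong_trans)
    have "\<not> int p dvd a * b"
      using ab assms by (simp add: prime_dvd_mult_iff)
    moreover have "[int r ^ (nat (L a) + nat (L b)) = a * b] (mod int p)"
      using L[OF ab(1)] L[OF ab(2)] by (simp add: power_add cong_mult)
    ultimately show "[L (a * b) = L a + L b] (mod int (p - 1))"
      using L_eqI L[OF ab(1)] L[OF ab(2)] by (metis of_nat_add)
  next
    fix t :: int
    have "int (nat (t mod int (p - 1))) = t mod int (p - 1)" using p by simp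
    then have "[L (int r ^ nat (t mod int (p - 1))) = t] (mod int (p - 1))"
      using L_eqI[OF unit cong_refl, of "nat (t mod int (p - 1))"] by (simp add: cong_def)
    then show "\<exists>a. \<not> int p dvd a \<and> [L a = t] (mod int (p - 1))" using unit by blast
  qed
qed

lemma not_dvd_mod_power_int:
  assumes "prime p" "\<not> int p dvd x"
  shows "\<not> int p dvd mod_power_int (int p) x e"
proof -
  have pp: "prime (int p)" using assms by simp
  have "coprime x (int p)"
    using pp assms(2) by (metis coprime_commute prime_imp_coprime)
  then have "coprime (modular_inverse (int p) x) (int p)" by simp
  then have "\<not> int p dvd modular_inverse (int p) x"
    using pp by (metis coprime_absorb_right not_prime_unit)
  then show ?thesis
    using assms(2) pp by (auto simp: mod_power_int_def dest: prime_dvd_power[OF pp])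
qed

text \<open>
  A homomorphism turns powers into multiples. For negative exponents this rests on the inverse of \<open>x\<close>
  having logarithm \<open>- L x\<close>.
\<close>
lemma log_mod_power_int:
  fixes L :: "int \<Rightarrow> int"
  assumes p: "prime p" and x: "\<not> int p dvd x"
    and cong: "\<And>a b. \<lbrakk>\<not> int p dvd a; \<not> int p dvd b; [a = b] (mod int p)\<rbrakk> \<Longrightarrow> [L a = L b] (mod n)"
    and mult: "\<And>a b. \<lbrakk>\<not> int p dvd a; \<not> int p dvd b\<rbrakk> \<Longrightarrow> [L (a * b) = L a + L b] (mod n)"
  shows "[L (mod_power_int (int p) x e) = e * L x] (mod n)"
proof -
  have pp: "prime (int p)" using p by simp
  have one: "\<not> int p dvd 1" using pp not_prime_unit by blast
  have L1: "[L 1 = 0] (mod n)"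
    using mult[OF one one] by (simp add: cong_iff_dvd_diff dvd_minus_iff)
  have pow: "[L (a ^ m) = int m * L a] (mod n)" if a: "\<not> int p dvd a" for a m
  proof (induction m)
    case 0
    show ?case using L1 by simp
  next
    case (Suc m)
    have "[L (a * a ^ m) = L a + L (a ^ m)] (mod n)"
      using a by (intro mult) (auto dest: prime_dvd_power[OF pp])
    also have "[L a + L (a ^ m) = L a + int m * L a] (mod n)"
      using Suc by (intro cong_add) auto
    finally show ?case by (simp add: algebra_simps)
  qed
  show ?thesis
  proof (cases "e \<ge> 0")
    case True
    then show ?thesis using pow[OF x, of "nat e"] by (simp add: mod_power_int_def)
  next
    case False
    define y where "y = modular_inverse (int p) x"
    have y: "\<not> int p dvd y"
      using not_dvd_mod_power_int[OF p x, of "-1"] by (simp add: mod_power_int_def y_def)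
    have "coprime x (int p)"
      using pp x by (metis coprime_commute prime_imp_coprime)
    then have "[x * y = 1] (mod int p)"
      unfolding y_def by (rule cong_modular_inverse1)
    then have "[L (x * y) = L 1] (mod n)"
      using x y pp one by (intro cong) (auto simp: prime_dvd_mult_iff)
    then have "[L x + L y = 0] (mod n)"
      using mult[OF x y] L1 by (metis cong_sym cong_trans)
    then have "[L y = - L x] (mod n)"
      by (simp add: cong_iff_dvd_diff add.commute)
    then have "[(- e) * L y = (- e) * (- L x)] (mod n)"
      by (rule cong_scalar_left)
    moreover have "[L (y ^ nat (- e)) = (- e) * L y] (mod n)"
      using pow[OF y, of "nat (- e)"] False by simp
    ultimately show ?thesis
      using False by (simp add: mod_power_int_def y_def[symmetric]) (metis cong_trans)
  qed
qed

text \<open>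
  The Chinese remainder theorem for the coprime moduli \<open>p\<close> and \<open>p - 1\<close>: the residue modulo \<open>p - 1\<close> is
  prescribed to be that of \<open>y\<close>, and the residue modulo \<open>p\<close> remains free among the units, which the
  logarithm counts.
\<close>
lemma bij_betw_log_fibre:
  fixes L :: "int \<Rightarrow> int" and n y :: int
  assumes p: "prime p" and n: "n = int p - 1"
    and cong: "\<And>a b. \<lbrakk>\<not> int p dvd a; \<not> int p dvd b\<rbrakk> \<Longrightarrow> [a = b] (mod int p) \<longleftrightarrow> [L a = L b] (mod n)"
    and surj: "\<And>t. \<exists>a. \<not> int p dvd a \<and> [L a = t] (mod n)"
  shows "bij_betw (\<lambda>x. L x mod n) {x \<in> {1..int p * n}. \<not> int p dvd x \<and> [x = y] (mod n)} {0..<n}"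
proof -
  have p1: "int p > 1" using p prime_gt_1_nat by fastforce
  then have n0: "n > 0" using n by simp
  have pn: "int p * n > 0" using p1 n0 by simp
  have cop: "coprime (int p) n"
    unfolding n by simp
  let ?U = "{x \<in> {1..int p * n}. \<not> int p dvd x \<and> [x = y] (mod n)}"
  have "inj_on (\<lambda>x. L x mod n) ?U"
  proof
    fix a b assume ab: "a \<in> ?U" "b \<in> ?U" "L a mod n = L b mod n"
    then have "[a = b] (mod int p)" using cong[of a b] by (simp add: cong_def)
    moreover have "[a = b] (mod n)" using ab by (auto intro: cong_trans cong_sym)
    ultimately have "[a = b] (mod int p * n)" using cop by (rule coprime_cong_mult)
    then have "int p * n dvd a - b" by (simp add: cong_iff_dvd_diff)
    moreover have "\<bar>a - b\<bar> < int p * n" using ab by auto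
    ultimately show "a = b" using dvd_imp_le_int[of "a - b" "int p * n"] pn by auto
  qed
  moreover have "t \<in> (\<lambda>x. L x mod n) ` ?U" if t: "t \<in> {0..<n}" for t
  proof -
    obtain a where a: "\<not> int p dvd a" "[L a = t] (mod n)" using surj by blast
    obtain w where w: "[w = a] (mod int p)" "[w = y] (mod n)"
      using binary_chinese_remainder_int[OF cop] by blast
    \<comment> \<open>the representative of \<open>w\<close> modulo \<open>p * n\<close> between \<open>1\<close> and \<open>p * n\<close>\<close>
    define x where "x = (w - 1) mod (int p * n) + 1"
    have "[x = w] (mod int p * n)"
      unfolding x_def by (metis cong_add_rcancel cong_mod_left cong_refl diff_add_cancel)
    then have x: "[x = w] (mod int p)" "[x = w] (mod n)"
      by (auto intro: cong_dvd_modulus)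
    have xa: "[x = a] (mod int p)" using x(1) w(1) by (rule cong_trans)
    have "x \<in> {1..int p * n}" using pn by (simp add: x_def add1_zle_eq)
    moreover have xu: "\<not> int p dvd x" using xa a(1) by (simp add: cong_dvd_iff)
    moreover have "[x = y] (mod n)" using x(2) w(2) by (rule cong_trans)
    moreover have "L x mod n = t"
      using cong[OF xu a(1)] xa a(2) t by (simp add: cong_def)
    ultimately show ?thesis by force
  qed
  ultimately show ?thesis using n0 by (auto simp: bij_betw_def)
qed

section \<open>Cycles of power congruences modulo a prime\<close>

lemma poly_cong_int:
  fixes g :: "int poly"
  assumes "[x = y] (mod m)"
  shows "[poly g x = poly g y] (mod m)"
  using assms by (induction g) (auto intro!: cong_add cong_mult)

text \<open>
  The contribution of a single tuple \<open>y\<close> of residues modulo \<open>p - 1\<close>. Fixing \<open>y\<close> fixes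
  the exponents \<open>g(x\<^sub>i)\<close> modulo \<open>p - 1\<close>, and logarithms then make the system linear.
\<close>
lemma card_cyclic_power_fibre:
  fixes p k :: nat and g :: "int poly" and y :: "nat \<Rightarrow> int"
  assumes p: "prime p" and k: "k \<ge> 1"
  defines "n \<equiv> int p - 1"
  shows "int (card {x \<in> (\<Pi>\<^sub>E i\<in>{1..k}. {x \<in> {1..int p * n}. \<not> int p dvd x \<and> [x = y i] (mod n)}).
             (\<forall>i\<in>{1..<k}. [mod_power_int (int p) (x i) (poly g (x i)) = x (i + 1)] (mod int p)) \<and>
             [mod_power_int (int p) (x k) (poly g (x k)) = x 1] (mod int p)})
         = gcd n ((\<Prod>i=1..k. poly g (y i)) - 1)"
proof -
  have n0: "n > 0" using prime_gt_1_nat[OF p] by (simp add: n_def)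
  have n_nat: "int (p - 1) = n" using prime_gt_1_nat[OF p] by (simp add: n_def)
  obtain L :: "int \<Rightarrow> int" where
    L_iff: "\<And>a b. \<lbrakk>\<not> int p dvd a; \<not> int p dvd b\<rbrakk> \<Longrightarrow> [a = b] (mod int p) \<longleftrightarrow> [L a = L b] (mod n)" and
    L_surj: "\<And>t. \<exists>a. \<not> int p dvd a \<and> [L a = t] (mod n)" and
    L_mult: "\<And>a b. \<lbrakk>\<not> int p dvd a; \<not> int p dvd b\<rbrakk> \<Longrightarrow> [L (a * b) = L a + L b] (mod n)"
    using obtain_discrete_log[OF p] unfolding n_nat by blast
  let ?F = "\<lambda>x. \<lambda>i\<in>{1..k}. L (x i) mod n"
  let ?X = "\<Pi>\<^sub>E i\<in>{1..k}. {x \<in> {1..int p * n}. \<not> int p dvd x \<and> [x = y i] (mod n)}"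
  have bij: "bij_betw ?F ?X ({1..k} \<rightarrow>\<^sub>E {0..<n})"
    by (intro bij_betw_PiE_componentwise bij_betw_log_fibre p L_iff L_surj) (auto simp: n_def)
  have step: "[mod_power_int (int p) a (poly g a) = b] (mod int p) \<longleftrightarrow>
      [poly g z * (L a mod n) = L b mod n] (mod n)"
    if a: "\<not> int p dvd a" and b: "\<not> int p dvd b" and z: "[a = z] (mod n)" for a b z
  proof -
    have log: "[L (mod_power_int (int p) a (poly g a)) = poly g a * L a] (mod n)"
      using p a L_iff L_mult by (intro log_mod_power_int) auto
    have "[poly g a * L a = poly g z * L a] (mod n)"
      using z by (intro cong_scalar_right poly_cong_int)
    with log have "[L (mod_power_int (int p) a (poly g a)) = poly g z * L a] (mod n)"
      by (rule cong_trans)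
    then show ?thesis
      using L_iff[OF not_dvd_mod_power_int[OF p a] b]
      by (simp add: cong_def mod_mult_right_eq)
  qed
  have "card {x \<in> ?X. (\<forall>i\<in>{1..<k}. [mod_power_int (int p) (x i) (poly g (x i)) = x (i + 1)] (mod int p)) \<and>
             [mod_power_int (int p) (x k) (poly g (x k)) = x 1] (mod int p)} =
      card {t \<in> {1..k} \<rightarrow>\<^sub>E {0..<n}. (\<forall>i\<in>{1..<k}. [poly g (y i) * t i = t (i + 1)] (mod n)) \<and>
             [poly g (y k) * t k = t 1] (mod n)}"
  proof (rule card_Collect_bij_betw[OF bij])
    fix x assume "x \<in> ?X"
    then have x: "\<not> int p dvd x i" "[x i = y i] (mod n)" if "i \<in> {1..k}" for i
      using that by (auto simp: PiE_iff)
    have "[mod_power_int (int p) (x i) (poly g (x i)) = x j] (mod int p) \<longleftrightarrow>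
        [poly g (y i) * ?F x i = ?F x j] (mod n)" if "i \<in> {1..k}" "j \<in> {1..k}" for i j
      using step[OF x(1)[OF that(1)] x(1)[OF that(2)] x(2)[OF that(1)]] that by simp
    then show "((\<forall>i\<in>{1..<k}. [mod_power_int (int p) (x i) (poly g (x i)) = x (i + 1)] (mod int p)) \<and>
        [mod_power_int (int p) (x k) (poly g (x k)) = x 1] (mod int p)) \<longleftrightarrow>
      ((\<forall>i\<in>{1..<k}. [poly g (y i) * ?F x i = ?F x (i + 1)] (mod n)) \<and>
        [poly g (y k) * ?F x k = ?F x 1] (mod n))"
      using k by (intro conj_cong ball_cong refl) auto
  qed
  then show ?thesis using card_linear_cycle[OF n0 k] by simp
qed

text \<open>
  The summation variable \<open>y\<close> of the gcd sum is the tuple of residues modulo \<open>p - 1\<close> of a solution,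
  and each gcd is the size of a fibre of the map that takes a solution to these residues.
\<close>
lemma card_cyclic_power_solutions:
  fixes p k :: nat and g :: "int poly"
  assumes p: "prime p" and k: "k \<ge> 1"
  shows "int (card {x :: nat \<Rightarrow> int. x \<in> {1..k} \<rightarrow>\<^sub>E {1..int p * (int p - 1)} \<and>
             (\<forall>i\<in>{1..k}. \<not> int p dvd x i) \<and>
             (\<forall>i\<in>{1..<k}. [mod_power_int (int p) (x i) (poly g (x i)) = x (i + 1)] (mod int p)) \<and>
             [mod_power_int (int p) (x k) (poly g (x k)) = x 1] (mod int p)})
         = (\<Sum>y \<in> {1..k} \<rightarrow>\<^sub>E {1..int p - 1}. gcd (int p - 1) ((\<Prod>i=1..k. poly g (y i)) - 1))"
    (is "int (card ?S) = _")
proof -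
  define n where "n = int p - 1"
  have n0: "n > 0" using prime_gt_1_nat[OF p] by (simp add: n_def)
  (* Residues modulo n are represented in {1..n}, where n and not 0 stands for the zero class. *)
  define c where "c x = (x - 1) mod n + 1" for x
  have c_range: "c x \<in> {1..n}" for x using n0 by (simp add: c_def add1_zle_eq)
  have c_iff: "c x = y \<longleftrightarrow> [x = y] (mod n)" if "y \<in> {1..n}" for x y
  proof -
    have "c x = y \<longleftrightarrow> (x - 1) mod n = (y - 1) mod n" using that by (auto simp: c_def)
    also have "\<dots> \<longleftrightarrow> [x = y] (mod n)" by (simp add: mod_eq_dvd_iff cong_iff_dvd_diff)
    finally show ?thesis .
  qed
  let ?r = "\<lambda>x. \<lambda>i\<in>{1..k}. c (x i)"
  let ?cyc = "\<lambda>x. (\<forall>i\<in>{1..<k}. [mod_power_int (int p) (x i) (poly g (x i)) = x (i + 1)] (mod int p)) \<and>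
             [mod_power_int (int p) (x k) (poly g (x k)) = x 1] (mod int p)"
  have fibre: "{x \<in> ?S. ?r x = y} =
      {x \<in> (\<Pi>\<^sub>E i\<in>{1..k}. {x \<in> {1..int p * n}. \<not> int p dvd x \<and> [x = y i] (mod n)}). ?cyc x}"
    if y: "y \<in> {1..k} \<rightarrow>\<^sub>E {1..n}" for y
  proof -
    have "?r x = y \<longleftrightarrow> (\<forall>i\<in>{1..k}. [x i = y i] (mod n))" for x
    proof -
      have "?r x = y \<longleftrightarrow> (\<forall>i\<in>{1..k}. c (x i) = y i)"
        using y by (auto simp: PiE_iff extensional_def restrict_def fun_eq_iff)
      then show ?thesis using y c_iff by (auto simp: PiE_iff)
    qed
    then show ?thesis by (auto simp: PiE_iff n_def)
  qed
  have "finite ({1..k} \<rightarrow>\<^sub>E {1..int p * (int p - 1)})" by (simp add: finite_PiE)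
  then have fin: "finite ?S" by (rule rev_finite_subset) auto
  have "card ?S = (\<Sum>y\<in>{1..k} \<rightarrow>\<^sub>E {1..n}. card {x \<in> ?S. ?r x = y})"
    using fin c_range by (intro card_eq_sum_card_fibres) (auto simp: finite_PiE)
  then have "int (card ?S) = (\<Sum>y\<in>{1..k} \<rightarrow>\<^sub>E {1..n}. int (card {x \<in> ?S. ?r x = y}))"
    by simp
  also have "\<dots> = (\<Sum>y\<in>{1..k} \<rightarrow>\<^sub>E {1..n}. gcd n ((\<Prod>i=1..k. poly g (y i)) - 1))"
    by (intro sum.cong refl, subst fibre, assumption,
        unfold n_def, rule card_cyclic_power_fibre[OF p k])
  finally show ?thesis by (simp only: n_def)
qed

section \<open>The sum over divisors\<close>

text \<open>
  Gauss' identity, with the sum running over the divisors of \<open>N\<close> instead of those of the gcd: the range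
  then does not depend on \<open>m\<close>, so that the sum can be exchanged with a sum over \<open>m\<close>.
\<close>
lemma gcd_eq_sum_totient:
  fixes N :: nat and m :: int
  assumes "N > 0"
  shows "gcd (int N) m = (\<Sum>d | d dvd N. if int d dvd m then int (totient d) else 0)"
proof -
  have "gcd (int N) m = int (gcd N (nat \<bar>m\<bar>))"
    by (metis gcd_int_int_eq gcd_abs2_int int_nat_eq abs_ge_zero)
  also have "\<dots> = (\<Sum>d | d dvd gcd N (nat \<bar>m\<bar>). int (totient d))"
    by (metis of_nat_sum totient_divisor_sum)
  also have "{d. d dvd gcd N (nat \<bar>m\<bar>)} = {d \<in> {d. d dvd N}. int d dvd m}"
    by (simp only: gcd_greatest_iff dvd_nat_abs_iff mem_Collect_eq)
  also have "(\<Sum>d\<in>{d \<in> {d. d dvd N}. int d dvd m}. int (totient d)) =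
      (\<Sum>d | d dvd N. if int d dvd m then int (totient d) else 0)"
    using assms by (subst sum.inter_filter) simp_all
  finally show ?thesis .
qed

lemma card_residue_class:
  fixes N d :: nat and z :: int
  assumes "N > 0" and "d dvd N" and "z \<in> {0..<int d}"
  shows "card {y \<in> {1..int N}. y mod int d = z} = N div d"
proof -
  obtain q where N: "N = d * q" using assms(2) by auto
  have d: "int d > 0" and q: "q > 0" using assms N by auto
  \<comment> \<open>in \<open>{1..N}\<close> the class of \<open>0\<close> is represented by \<open>d\<close>, not by \<open>0\<close>\<close>
  define z' where "z' = (if z = 0 then int d else z)"
  have z': "z' \<in> {1..int d}" "z' mod int d = z" using assms d by (auto simp: z'_def)
  have "bij_betw (\<lambda>j. z' + int d * j) {0..<int q} {y \<in> {1..int N}. y mod int d = z}"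
  proof (rule bij_betwI[where g = "\<lambda>y. (y - z') div int d"])
    show "(\<lambda>j. z' + int d * j) \<in> {0..<int q} \<rightarrow> {y \<in> {1..int N}. y mod int d = z}"
    proof
      fix j assume j: "j \<in> {0..<int q}"
      have "int d * j \<ge> 0" using j by simp
      moreover have "int d * (j + 1) \<le> int d * int q" using j by (intro mult_left_mono) auto
      ultimately show "z' + int d * j \<in> {y \<in> {1..int N}. y mod int d = z}"
        using z' by (auto simp: N algebra_simps)
    qed
    show "(\<lambda>y. (y - z') div int d) \<in> {y \<in> {1..int N}. y mod int d = z} \<rightarrow> {0..<int q}"
    proof
      fix y assume y: "y \<in> {y \<in> {1..int N}. y mod int d = z}"
      have "y - z' > - int d" using y z' by auto
      moreover have "int d dvd y - z'" using y z' by (simp flip: mod_eq_dvd_iff)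
      then obtain c where c: "y - z' = int d * c" by auto
      ultimately have "int d * (-1) < int d * c" by simp
      then have "c \<ge> 0" using d by (simp only: mult_less_cancel_left_pos)
      moreover have "int d * c < int d * int q"
        unfolding c[symmetric] using y z' by (auto simp: N)
      then have "c < int q" by (simp only: mult_less_cancel_left_pos[OF d])
      ultimately show "(y - z') div int d \<in> {0..<int q}" using c d by simp
    qed
  next
    fix y assume y: "y \<in> {y \<in> {1..int N}. y mod int d = z}"
    then have "int d dvd y - z'" using z' by (simp flip: mod_eq_dvd_iff)
    then show "z' + int d * ((y - z') div int d) = y" by simp
  qed (use d in auto)
  then have "card {0..<int q} = card {y \<in> {1..int N}. y mod int d = z}"
    by (rule bij_betw_same_card)
  then show ?thesis using d by (simp add: N)
qed

text \<open>
  Reduction modulo \<open>d\<close> maps onto the tuples counted by \<open>N_G_minus_1\<close>, and all its fibres are products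
  of \<open>k\<close> residue classes with \<open>N / d\<close> elements each.
\<close>
lemma card_tuples_product_cong_1:
  fixes N d k :: nat and g :: "int poly"
  assumes "N > 0" and "d dvd N"
  shows "card {y \<in> {1..k} \<rightarrow>\<^sub>E {1..int N}. int d dvd (\<Prod>i=1..k. poly g (y i)) - 1} =
    (N div d) ^ k * N_G_minus_1 g k d"
proof -
  have d: "int d > 0" using assms by (auto intro: Nat.gr0I)
  let ?I = "{1..k}"
  let ?S = "{y \<in> ?I \<rightarrow>\<^sub>E {1..int N}. int d dvd (\<Prod>i=1..k. poly g (y i)) - 1}"
  let ?Z = "{z \<in> ?I \<rightarrow>\<^sub>E {0..<int d}. [(\<Prod>i=1..k. poly g (z i)) - 1 = 0] (mod int d)}"
  let ?r = "\<lambda>y. \<lambda>i\<in>?I. y i mod int d"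
  have fin: "finite ?S" "finite ?Z"
    by (simp_all add: finite_PiE)
  have red: "int d dvd (\<Prod>i=1..k. poly g (?r y i)) - 1 \<longleftrightarrow> int d dvd (\<Prod>i=1..k. poly g (y i)) - 1" for y
  proof -
    have "[(\<Prod>i=1..k. poly g (?r y i)) = (\<Prod>i=1..k. poly g (y i))] (mod int d)"
      by (intro cong_prod poly_cong_int) simp
    then have "[(\<Prod>i=1..k. poly g (?r y i)) - 1 = (\<Prod>i=1..k. poly g (y i)) - 1] (mod int d)"
      by (intro cong_diff) auto
    then show ?thesis by (simp add: cong_dvd_iff)
  qed
  have fibre: "card {y \<in> ?S. ?r y = z} = (N div d) ^ k" if z: "z \<in> ?Z" for z
  proof -
    have "{y \<in> ?S. ?r y = z} = (\<Pi>\<^sub>E i\<in>?I. {y \<in> {1..int N}. y mod int d = z i})"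
    proof (intro equalityI subsetI)
      fix y assume "y \<in> {y \<in> ?S. ?r y = z}"
      then show "y \<in> (\<Pi>\<^sub>E i\<in>?I. {y \<in> {1..int N}. y mod int d = z i})"
        by (auto simp: PiE_iff)
    next
      fix y assume y: "y \<in> (\<Pi>\<^sub>E i\<in>?I. {y \<in> {1..int N}. y mod int d = z i})"
      then have "?r y = z"
        using z by (intro ext) (auto simp: PiE_iff extensional_def restrict_def)
      moreover have "y \<in> ?S"
        using y z red[of y] \<open>?r y = z\<close> by (auto simp: PiE_iff cong_0_iff)
      ultimately show "y \<in> {y \<in> ?S. ?r y = z}" by simp
    qed
    also have "card \<dots> = (\<Prod>i\<in>?I. card {y \<in> {1..int N}. y mod int d = z i})"
      by (rule card_PiE) simp
    also have "\<dots> = (\<Prod>i\<in>?I. N div d)"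
      using z assms by (intro prod.cong refl card_residue_class) (auto simp: PiE_iff)
    finally show ?thesis by simp
  qed
  have "?r ` ?S \<subseteq> ?Z"
    using red d by (auto simp: cong_0_iff)
  from card_eq_sum_card_fibres[OF fin this] show ?thesis
    using fibre by (simp add: N_G_minus_1_def)
qed

lemma sum_gcd_eq_sum_totient:
  fixes N k :: nat and g :: "int poly"
  assumes "N > 0"
  shows "(\<Sum>y \<in> {1..k} \<rightarrow>\<^sub>E {1..int N}. gcd (int N) ((\<Prod>i=1..k. poly g (y i)) - 1)) =
    int (\<Sum>d | d dvd N. totient d * (N div d) ^ k * N_G_minus_1 g k d)"
proof -
  let ?Y = "{1..k} \<rightarrow>\<^sub>E {1..int N}" and ?P = "\<lambda>y. (\<Prod>i=1..k. poly g (y i)) - 1"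
  have fin: "finite ?Y" by (simp add: finite_PiE)
  have "(\<Sum>y\<in>?Y. gcd (int N) (?P y)) =
      (\<Sum>y\<in>?Y. \<Sum>d | d dvd N. if int d dvd ?P y then int (totient d) else 0)"
    using gcd_eq_sum_totient[OF assms] by simp
  also have "\<dots> = (\<Sum>d | d dvd N. \<Sum>y\<in>?Y. if int d dvd ?P y then int (totient d) else 0)"
    by (rule sum.swap)
  also have "\<dots> = (\<Sum>d | d dvd N. int (totient d * card {y \<in> ?Y. int d dvd ?P y}))"
    using fin by (simp add: mult.commute flip: sum.inter_filter)
  also have "\<dots> = (\<Sum>d | d dvd N. int (totient d * ((N div d) ^ k * N_G_minus_1 g k d)))"
    using card_tuples_product_cong_1[OF assms] by (intro sum.cong refl) simp
  finally show ?thesis by (simp add: mult.assoc)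
qed

section \<open>The number of solutions\<close>

theorem corollary13:
  fixes p k :: nat and g :: "int poly"
  assumes "prime p" and "k \<ge> 1"
  shows "int (card {x :: nat \<Rightarrow> int. x \<in> {1..k} \<rightarrow>\<^sub>E {1..int p * (int p - 1)} \<and>
             (\<forall>i\<in>{1..k}. \<not> int p dvd x i) \<and>
             (\<forall>i\<in>{1..<k}. [mod_power_int (int p) (x i) (poly g (x i)) = x (i + 1)] (mod int p)) \<and>
             [mod_power_int (int p) (x k) (poly g (x k)) = x 1] (mod int p)})
         = (\<Sum>y \<in> {1..k} \<rightarrow>\<^sub>E {1..int p - 1}. gcd (int p - 1) ((\<Prod>i=1..k. poly g (y i)) - 1))
         \<and> (\<Sum>y \<in> {1..k} \<rightarrow>\<^sub>E {1..int p - 1}. gcd (int p - 1) ((\<Prod>i=1..k. poly g (y i)) - 1))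
         = int (\<Sum>d | d dvd p - 1. totient d * ((p - 1) div d) ^ k * N_G_minus_1 g k d)"
proof
  have p: "p > 1" using assms(1) by (rule prime_gt_1_nat)
  then have "int p - 1 = int (p - 1)" by simp
  with p show "(\<Sum>y \<in> {1..k} \<rightarrow>\<^sub>E {1..int p - 1}. gcd (int p - 1) ((\<Prod>i=1..k. poly g (y i)) - 1))
      = int (\<Sum>d | d dvd p - 1. totient d * ((p - 1) div d) ^ k * N_G_minus_1 g k d)"
    using sum_gcd_eq_sum_totient[of "p - 1" g k] by simp
qed (rule card_cyclic_power_solutions[OF assms])

end
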